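(* Every Artinian meet-continuous dcpo $P$ is an algebraic domain. Consequently, $\Sigma P$ is sober and $$\sigma(P\times P)=\sigma(P)\times\sigma(P),$$ where the left-hand side is the Scott topology of the coordinatewise order and the right-hand side is the product topology. In particular, every Artinian meet-continuous complete lattice is algebraic.
   Context: A dcpo is a poset in which every directed (nonempty) subset has a supremum. For a poset $P$, $\sigma(P)$ is the Scott topology: $U$ is open iff it is an upper set and every directed $D$ with existing supremum $\bigvee D\in U$ meets $U$; $\Sigma P=(P,\sigma(P))$. A poset $P$ is meet-continuous if for every directed $D\subseteq P$ whose supremum exists and every $x\le\bigvee D$, $x$ lies in the $\sigma(P)$-closure of ${\downarrow}D\cap{\downarrow}x$. (For a complete lattice this is equivalent to $x\wedge\bigvee D=\bigvee_{d\in D}(x\wedge d)$ for all $x$ and directed $D$.) A poset is Artinian if every nonempty subset has a minimal element. An element $k$ of a dcpo $P$ is compact if for every directed $D$ with $k\le\bigvee D$ there is $d\in D$ with $k\le d$; $P$ is an algebraic domain (algebraic) if for every $x\in P$ the set of compact elements below $x$ is directed with supremum $x$. A $T_0$ space is sober if every (nonempty) irreducible closed subset is the closure of a unique point. *)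

theory Defs
  imports "HOL-Analysis.Analysis" "HOL-Algebra.Complete_Lattice"
begin

text \<open>Posets are the carrier-based \<^locale>\<open>partial_order\<close> structures of HOL-Algebra; the carrier
  may be empty.\<close>

definition directed :: "('a, 'm) gorder_scheme \<Rightarrow> 'a set \<Rightarrow> bool" where
  "directed P D \<longleftrightarrow> D \<subseteq> carrier P \<and> D \<noteq> {} \<and>
     (\<forall>x\<in>D. \<forall>y\<in>D. \<exists>z\<in>D. x \<sqsubseteq>\<^bsub>P\<^esub> z \<and> y \<sqsubseteq>\<^bsub>P\<^esub> z)"

locale dcpo = partial_order +
  assumes directed_sup_exists: "directed L D \<Longrightarrow> \<exists>s. is_lub L s D"

definition down_set :: "('a, 'm) gorder_scheme \<Rightarrow> 'a set \<Rightarrow> 'a set" where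
  "down_set P A = {x \<in> carrier P. \<exists>a\<in>A. x \<sqsubseteq>\<^bsub>P\<^esub> a}"

definition artinian :: "('a, 'm) gorder_scheme \<Rightarrow> bool" where
  "artinian P \<longleftrightarrow>
     (\<forall>S. S \<subseteq> carrier P \<and> S \<noteq> {} \<longrightarrow> (\<exists>m\<in>S. \<forall>y\<in>S. y \<sqsubseteq>\<^bsub>P\<^esub> m \<longrightarrow> y = m))"

definition scott_open :: "('a, 'm) gorder_scheme \<Rightarrow> 'a set \<Rightarrow> bool" where
  "scott_open P U \<longleftrightarrow> U \<subseteq> carrier P \<and>
     (\<forall>x\<in>U. \<forall>y\<in>carrier P. x \<sqsubseteq>\<^bsub>P\<^esub> y \<longrightarrow> y \<in> U) \<and>
     (\<forall>D s. directed P D \<and> is_lub P s D \<and> s \<in> U \<longrightarrow> D \<inter> U \<noteq> {})"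

definition scott_topology :: "('a, 'm) gorder_scheme \<Rightarrow> 'a topology" where
  "scott_topology P = topology (scott_open P)"

lemma istopology_scott_open: "istopology (scott_open P)"
  unfolding istopology_def
proof (intro conjI allI impI)
  fix U V assume U: "scott_open P U" and V: "scott_open P V"
  have "D \<inter> (U \<inter> V) \<noteq> {}"
    if D: "directed P D" and s: "is_lub P s D" "s \<in> U \<inter> V" for D s
  proof -
    obtain a b where "a \<in> D" "a \<in> U" "b \<in> D" "b \<in> V"
      using U V D s unfolding scott_open_def by blast
    moreover then obtain z where "z \<in> D" "a \<sqsubseteq>\<^bsub>P\<^esub> z" "b \<sqsubseteq>\<^bsub>P\<^esub> z"
      using D unfolding directed_def by blast
    moreover have "z \<in> carrier P"
      using \<open>z \<in> D\<close> D unfolding directed_def by blast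
    ultimately show ?thesis
      using U V unfolding scott_open_def by blast
  qed
  then show "scott_open P (U \<inter> V)"
    using U V unfolding scott_open_def by blast
next
  fix K assume K: "\<forall>U\<in>K. scott_open P U"
  have "D \<inter> \<Union>K \<noteq> {}" if D: "directed P D" "is_lub P s D" "s \<in> \<Union>K" for D s
  proof -
    obtain U where "U \<in> K" "s \<in> U" using D(3) by blast
    then have "D \<inter> U \<noteq> {}" using K D unfolding scott_open_def by blast
    then show ?thesis using \<open>U \<in> K\<close> by blast
  qed
  moreover have "\<Union>K \<subseteq> carrier P"
    using K unfolding scott_open_def by blast
  moreover have "\<forall>x\<in>\<Union>K. \<forall>y\<in>carrier P. x \<sqsubseteq>\<^bsub>P\<^esub> y \<longrightarrow> y \<in> \<Union>K"
    using K unfolding scott_open_def by blast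
  ultimately show "scott_open P (\<Union>K)"
    unfolding scott_open_def by blast
qed

lemma openin_scott_topology [simp]: "openin (scott_topology P) U \<longleftrightarrow> scott_open P U"
  by (simp add: scott_topology_def istopology_scott_open topology_inverse')

lemma topspace_scott_topology [simp]: "topspace (scott_topology P) = carrier P"
proof
  show "topspace (scott_topology P) \<subseteq> carrier P"
    by (auto simp: topspace_def scott_open_def)
  have "scott_open P (carrier P)"
    unfolding scott_open_def directed_def by blast
  then show "carrier P \<subseteq> topspace (scott_topology P)"
    by (auto simp: topspace_def)
qed

definition meet_continuous :: "('a, 'm) gorder_scheme \<Rightarrow> bool" where
  "meet_continuous P \<longleftrightarrow>
     (\<forall>D s. directed P D \<and> is_lub P s D \<longrightarrow>
       (\<forall>x\<in>carrier P. x \<sqsubseteq>\<^bsub>P\<^esub> s \<longrightarrow>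
         x \<in> scott_topology P closure_of (down_set P D \<inter> down_set P {x})))"

definition compact_element :: "('a, 'm) gorder_scheme \<Rightarrow> 'a \<Rightarrow> bool" where
  "compact_element P k \<longleftrightarrow> k \<in> carrier P \<and>
     (\<forall>D s. directed P D \<and> is_lub P s D \<and> k \<sqsubseteq>\<^bsub>P\<^esub> s \<longrightarrow> (\<exists>d\<in>D. k \<sqsubseteq>\<^bsub>P\<^esub> d))"

locale algebraic_domain = dcpo +
  assumes compact_below_directed:
      "x \<in> carrier L \<Longrightarrow> directed L {k. compact_element L k \<and> k \<sqsubseteq> x}"
    and compact_below_lub:
      "x \<in> carrier L \<Longrightarrow> is_lub L x {k. compact_element L k \<and> k \<sqsubseteq> x}"

definition irreducible_closed :: "'a topology \<Rightarrow> 'a set \<Rightarrow> bool" where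
  "irreducible_closed X C \<longleftrightarrow> closedin X C \<and> C \<noteq> {} \<and>
     (\<forall>A B. closedin X A \<and> closedin X B \<and> C \<subseteq> A \<union> B \<longrightarrow> C \<subseteq> A \<or> C \<subseteq> B)"

definition sober_space :: "'a topology \<Rightarrow> bool" where
  "sober_space X \<longleftrightarrow> t0_space X \<and>
     (\<forall>C. irreducible_closed X C \<longrightarrow> (\<exists>!x. x \<in> topspace X \<and> X closure_of {x} = C))"

definition prod_order :: "('a, 'm) gorder_scheme \<Rightarrow> ('b, 'n) gorder_scheme \<Rightarrow> ('a \<times> 'b) gorder" where
  "prod_order P Q =
     \<lparr>carrier = carrier P \<times> carrier Q,
      eq = (\<lambda>p q. fst p .=\<^bsub>P\<^esub> fst q \<and> snd p .=\<^bsub>Q\<^esub> snd q),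
      le = (\<lambda>p q. fst p \<sqsubseteq>\<^bsub>P\<^esub> fst q \<and> snd p \<sqsubseteq>\<^bsub>Q\<^esub> snd q)\<rparr>"

lemma partial_order_prod_order:
  assumes "partial_order P" "partial_order Q"
  shows "partial_order (prod_order P Q)"
proof -
  interpret P: partial_order P by fact
  interpret Q: partial_order Q by fact
  show ?thesis
    by unfold_locales
      (auto simp: prod_order_def P.eq_is_equal Q.eq_is_equal fun_eq_iff
        intro: P.le_trans Q.le_trans P.le_antisym Q.le_antisym)
qed

end

theory Submission
  imports Defs
begin

text \<open>A minimal element k of a Scott open set U in a meet-continuous poset is compact: if k lies
  below the supremum of a directed set D, then k is in the closure of the elements below k and D,
  so U contains such an element, which by minimality is k. In an Artinian poset every point of
  U is therefore above a compact element of U. Applied to the complements of principal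
  ideals and to intersections of principal filters of compact elements, this yields algebraicity;
  sobriety and the product formula hold for all algebraic domains.\<close>

section \<open>Suprema, Scott open sets and Scott closed sets\<close>

text \<open>The guards \<open>d \<in> carrier P\<close> come from \<open>Upper\<close>, which tests
  only members of the set that lie in the carrier. The unfolding rests on no order axioms, so it
  applies directly to \<open>prod_order\<close>.\<close>

lemma is_lub_iff:
  "is_lub P s D \<longleftrightarrow> s \<in> carrier P \<and> (\<forall>d\<in>D. d \<in> carrier P \<longrightarrow> d \<sqsubseteq>\<^bsub>P\<^esub> s) \<and>
     (\<forall>u\<in>carrier P. (\<forall>d\<in>D. d \<in> carrier P \<longrightarrow> d \<sqsubseteq>\<^bsub>P\<^esub> u) \<longrightarrow> s \<sqsubseteq>\<^bsub>P\<^esub> u)"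
  unfolding least_def Upper_def by blast

lemma scott_openD_up: "scott_open P U \<Longrightarrow> x \<in> U \<Longrightarrow> y \<in> carrier P \<Longrightarrow> x \<sqsubseteq>\<^bsub>P\<^esub> y \<Longrightarrow> y \<in> U"
  unfolding scott_open_def by blast

lemma scott_openD_inacc: "scott_open P U \<Longrightarrow> directed P D \<Longrightarrow> is_lub P s D \<Longrightarrow> s \<in> U \<Longrightarrow> \<exists>d\<in>D. d \<in> U"
  unfolding scott_open_def by blast

lemma compact_elementD:
  "compact_element P k \<Longrightarrow> directed P D \<Longrightarrow> is_lub P s D \<Longrightarrow> k \<sqsubseteq>\<^bsub>P\<^esub> s \<Longrightarrow> \<exists>d\<in>D. k \<sqsubseteq>\<^bsub>P\<^esub> d"
  unfolding compact_element_def by blast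

text \<open>Contraposition of the two clauses of \<open>scott_open\<close> for the complement: upper
  becomes lower, and inaccessibility by directed suprema becomes closure under them.\<close>

lemma closedin_scott_topology_iff:
  "closedin (scott_topology P) C \<longleftrightarrow> C \<subseteq> carrier P \<and>
     (\<forall>x\<in>C. \<forall>y\<in>carrier P. y \<sqsubseteq>\<^bsub>P\<^esub> x \<longrightarrow> y \<in> C) \<and>
     (\<forall>D s. directed P D \<and> is_lub P s D \<and> D \<subseteq> C \<longrightarrow> s \<in> C)"
proof
  assume C: "closedin (scott_topology P) C"
  then have sub: "C \<subseteq> carrier P" and op: "scott_open P (carrier P - C)"
    by (auto simp: closedin_def)
  have "s \<in> C" if "directed P D" "is_lub P s D" "D \<subseteq> C" for D s
    using scott_openD_inacc[OF op that(1,2)] that(2,3) by (auto simp: is_lub_iff)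
  moreover have "y \<in> C" if "x \<in> C" "y \<in> carrier P" "y \<sqsubseteq>\<^bsub>P\<^esub> x" for x y
    using scott_openD_up[OF op, of y x] that sub by blast
  ultimately show "C \<subseteq> carrier P \<and>
     (\<forall>x\<in>C. \<forall>y\<in>carrier P. y \<sqsubseteq>\<^bsub>P\<^esub> x \<longrightarrow> y \<in> C) \<and>
     (\<forall>D s. directed P D \<and> is_lub P s D \<and> D \<subseteq> C \<longrightarrow> s \<in> C)"
    using sub by blast
next
  assume C: "C \<subseteq> carrier P \<and>
     (\<forall>x\<in>C. \<forall>y\<in>carrier P. y \<sqsubseteq>\<^bsub>P\<^esub> x \<longrightarrow> y \<in> C) \<and>
     (\<forall>D s. directed P D \<and> is_lub P s D \<and> D \<subseteq> C \<longrightarrow> s \<in> C)"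
  have "D \<inter> (carrier P - C) \<noteq> {}"
    if D: "directed P D" "is_lub P s D" "s \<in> carrier P - C" for D s
  proof -
    have "\<not> D \<subseteq> C"
      using C D by (metis DiffD2)
    moreover have "D \<subseteq> carrier P"
      using D(1) by (simp add: directed_def)
    ultimately show ?thesis
      by auto
  qed
  moreover have "y \<notin> C" if "x \<notin> C" "x \<in> carrier P" "x \<sqsubseteq>\<^bsub>P\<^esub> y" for x y
    using C that by metis
  ultimately have "scott_open P (carrier P - C)"
    unfolding scott_open_def by auto
  then show "closedin (scott_topology P) C"
    using C by (simp add: closedin_def)
qed

section \<open>Principal ideals, separation and compact elements in posets\<close>

context partial_order
begin

text \<open>A directed set inside the ideal has \<open>y\<close> as an upper bound, so its supremum
  is again below \<open>y\<close>.\<close>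

lemma closedin_down_set_singleton:
  assumes "y \<in> carrier L"
  shows "closedin (scott_topology L) (down_set L {y})"
  unfolding closedin_scott_topology_iff down_set_def is_lub_iff
  using assms by (auto intro: le_trans)

lemma closure_of_singleton_scott:
  assumes "y \<in> carrier L"
  shows "scott_topology L closure_of {y} = down_set L {y}"
proof (rule closure_of_unique)
  show "{y} \<subseteq> down_set L {y}"
    using assms by (simp add: down_set_def)
  show "closedin (scott_topology L) (down_set L {y})"
    using assms by (rule closedin_down_set_singleton)
  show "down_set L {y} \<subseteq> T" if "{y} \<subseteq> T" "closedin (scott_topology L) T" for T
    using that unfolding closedin_scott_topology_iff down_set_def by blast
qed

lemma down_set_singleton_inject:
  assumes "x \<in> carrier L" "y \<in> carrier L" "down_set L {x} = down_set L {y}"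
  shows "x = y"
proof -
  have "x \<in> down_set L {y}" "y \<in> down_set L {x}"
    using assms(1,2) assms(3)[symmetric] by (auto simp: down_set_def)
  then show ?thesis
    using assms by (auto simp: down_set_def intro: le_antisym)
qed

lemma t0_space_scott_topology: "t0_space (scott_topology L)"
  unfolding t0_space_def
proof (intro ballI impI)
  fix x y assume "x \<in> topspace (scott_topology L)" "y \<in> topspace (scott_topology L)" "x \<noteq> y"
  then have xy: "x \<in> carrier L" "y \<in> carrier L" and "\<not> (x \<sqsubseteq> y \<and> y \<sqsubseteq> x)"
    using le_antisym by auto
  \<comment> \<open>The complement of \<open>down_set L {y}\<close> contains \<open>x\<close> but
    not \<open>y\<close> unless \<open>x \<sqsubseteq> y\<close>; the complement of
    \<open>down_set L {x}\<close> contains \<open>y\<close> but not \<open>x\<close> unless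
    \<open>y \<sqsubseteq> x\<close>. Antisymmetry excludes that both inequalities hold.\<close>
  then have "(x \<notin> carrier L - down_set L {y}) = (y \<in> carrier L - down_set L {y}) \<or>
      (x \<notin> carrier L - down_set L {x}) = (y \<in> carrier L - down_set L {x})"
    by (auto simp: down_set_def)
  moreover have "openin (scott_topology L) (carrier L - down_set L {z})" if "z \<in> carrier L" for z
    using closedin_down_set_singleton[OF that] by (simp add: closedin_def)
  ultimately show "\<exists>U. openin (scott_topology L) U \<and> (x \<notin> U) = (y \<in> U)"
    using xy by metis
qed

text \<open>Inaccessibility of the principal filter of \<open>k\<close> by directed suprema is
  exactly compactness of \<open>k\<close>.\<close>

lemma scott_open_up_compact:
  assumes "compact_element L k"
  shows "scott_open L {z \<in> carrier L. k \<sqsubseteq> z}"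
proof -
  have k: "k \<in> carrier L"
    using assms by (simp add: compact_element_def)
  have "D \<inter> {z \<in> carrier L. k \<sqsubseteq> z} \<noteq> {}"
    if D: "directed L D" and s: "is_lub L s D" "k \<sqsubseteq> s" for D s
  proof -
    obtain d where "d \<in> D" "k \<sqsubseteq> d"
      using compact_elementD[OF assms D s] by blast
    moreover have "D \<subseteq> carrier L"
      using D by (simp add: directed_def)
    ultimately show ?thesis
      by auto
  qed
  then show ?thesis
    using k unfolding scott_open_def by (auto intro: le_trans)
qed

lemma minimal_in_scott_open_compact:
  assumes mc: "meet_continuous L" and U: "scott_open L U" and k: "k \<in> U"
    and minimal: "\<And>z. z \<in> U \<Longrightarrow> z \<sqsubseteq> k \<Longrightarrow> z = k"
  shows "compact_element L k"
  unfolding compact_element_def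
proof (intro conjI allI impI)
  show kc: "k \<in> carrier L"
    using U k unfolding scott_open_def by blast
  fix D s assume "directed L D \<and> is_lub L s D \<and> k \<sqsubseteq> s"
  then have "k \<in> scott_topology L closure_of (down_set L D \<inter> down_set L {k})"
    using mc kc unfolding meet_continuous_def by blast
  then obtain z where "z \<in> U" "z \<in> down_set L D" "z \<in> down_set L {k}"
    using U k by (auto simp: in_closure_of)
  then show "\<exists>d\<in>D. k \<sqsubseteq> d"
    using minimal[of z] by (auto simp: down_set_def)
qed

text \<open>The Artinian property is applied to the part of \<open>U\<close> below \<open>x\<close>,
  not to \<open>U\<close> itself, so that the minimal point obtained also lies below
  \<open>x\<close>.\<close>

lemma compact_in_scott_open:
  assumes "artinian L" "meet_continuous L" and U: "scott_open L U" and x: "x \<in> U"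
  obtains k where "compact_element L k" "k \<in> U" "k \<sqsubseteq> x"
proof -
  have UL: "U \<subseteq> carrier L"
    using U unfolding scott_open_def by blast
  have "{z \<in> U. z \<sqsubseteq> x} \<subseteq> carrier L" "x \<in> {z \<in> U. z \<sqsubseteq> x}"
    using UL x by auto
  then obtain k where k: "k \<in> U" "k \<sqsubseteq> x" and min: "\<forall>y\<in>{z \<in> U. z \<sqsubseteq> x}. y \<sqsubseteq> k \<longrightarrow> y = k"
    using \<open>artinian L\<close> unfolding artinian_def by blast
  \<comment> \<open>Minimality below \<open>x\<close> is minimality in all of \<open>U\<close>,
    because anything below \<open>k\<close> is also below \<open>x\<close>.\<close>
  have "z = k" if "z \<in> U" "z \<sqsubseteq> k" for z
    using min that k UL x le_trans[of z k x] by blast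
  then show thesis
    using that k minimal_in_scott_open_compact[OF assms(2) U] by blast
qed

end

section \<open>Algebraicity\<close>

lemma (in dcpo) algebraic_domain_if_artinian_meet_continuous:
  assumes "artinian L" "meet_continuous L"
  shows "algebraic_domain L"
proof unfold_locales
  fix x assume x: "x \<in> carrier L"
  let ?K = "{k. compact_element L k \<and> k \<sqsubseteq> x}"
  have K: "?K \<subseteq> carrier L"
    unfolding compact_element_def by blast
  show "directed L ?K"
    unfolding directed_def
  proof (intro conjI ballI)
    \<comment> \<open>The whole carrier serves as the open neighbourhood of \<open>x\<close> that
      yields one compact element below \<open>x\<close>.\<close>
    have "scott_open L (carrier L)"
      using openin_topspace[of "scott_topology L"] by simp
    then show "?K \<noteq> {}"
      using compact_in_scott_open[OF assms _ x] by blast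
    \<comment> \<open>The filters of \<open>k\<close> and \<open>l\<close> are both open and contain
      \<open>x\<close>. A compact element of their intersection below \<open>x\<close> is an upper
      bound of \<open>k\<close> and \<open>l\<close> within \<open>?K\<close>.\<close>
    fix k l assume "k \<in> ?K" "l \<in> ?K"
    then have "scott_open L {z \<in> carrier L. k \<sqsubseteq> z}" "scott_open L {z \<in> carrier L. l \<sqsubseteq> z}"
      and mem: "x \<in> {z \<in> carrier L. k \<sqsubseteq> z} \<inter> {z \<in> carrier L. l \<sqsubseteq> z}"
      using x scott_open_up_compact by auto
    then have "scott_open L ({z \<in> carrier L. k \<sqsubseteq> z} \<inter> {z \<in> carrier L. l \<sqsubseteq> z})"
      using openin_Int[of "scott_topology L"] by simp
    from compact_in_scott_open[OF assms this mem]
    show "\<exists>m\<in>?K. k \<sqsubseteq> m \<and> l \<sqsubseteq> m"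
      by blast
  qed (rule K)
  \<comment> \<open>If \<open>x\<close> were not below the upper bound \<open>u\<close>, the
    complement of the ideal of \<open>u\<close> would be an open neighbourhood of \<open>x\<close>
    and contain a member of \<open>?K\<close> not below \<open>u\<close>.\<close>
  have "x \<sqsubseteq> u" if u: "u \<in> carrier L" "\<forall>k\<in>?K. k \<in> carrier L \<longrightarrow> k \<sqsubseteq> u" for u
  proof (rule ccontr)
    assume "\<not> x \<sqsubseteq> u"
    then have mem: "x \<in> carrier L - down_set L {u}"
      using x by (simp add: down_set_def)
    have "scott_open L (carrier L - down_set L {u})"
      using closedin_down_set_singleton[OF u(1)] by (simp add: closedin_def)
    from compact_in_scott_open[OF assms this mem] u(2) show False
      unfolding down_set_def by blast
  qed
  then show "is_lub L x ?K"
    using x unfolding is_lub_iff by blast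
qed

section \<open>Sobriety of algebraic domains\<close>

context algebraic_domain
begin

text \<open>\<open>x\<close> is the supremum of the directed set of compact elements below it, so an
  open set containing \<open>x\<close> contains one of these.\<close>

lemma compact_in_scott_open_algebraic:
  assumes "scott_open L U" "x \<in> U"
  obtains k where "compact_element L k" "k \<in> U" "k \<sqsubseteq> x"
proof -
  have "x \<in> carrier L"
    using assms unfolding scott_open_def by blast
  then show thesis
    using scott_openD_inacc[OF assms(1) compact_below_directed compact_below_lub assms(2)] that
    by blast
qed

text \<open>The generic point is the supremum of the compact elements of \<open>C\<close>.
  Irreducibility makes them directed, closedness puts the supremum into \<open>C\<close>, and
  algebraicity puts every point of \<open>C\<close> below it.\<close>

lemma irreducible_closed_generic_point:
  assumes "irreducible_closed (scott_topology L) C"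
  obtains s where "s \<in> carrier L" "C = down_set L {s}"
proof -
  have closed: "closedin (scott_topology L) C" and ne: "C \<noteq> {}"
    and irr: "\<And>A B. closedin (scott_topology L) A \<Longrightarrow> closedin (scott_topology L) B \<Longrightarrow>
      C \<subseteq> A \<union> B \<Longrightarrow> C \<subseteq> A \<or> C \<subseteq> B"
    using assms unfolding irreducible_closed_def by blast+
  have CL: "C \<subseteq> carrier L" and lower: "\<And>x y. x \<in> C \<Longrightarrow> y \<in> carrier L \<Longrightarrow> y \<sqsubseteq> x \<Longrightarrow> y \<in> C"
    and sups: "\<And>D s. directed L D \<Longrightarrow> is_lub L s D \<Longrightarrow> D \<subseteq> C \<Longrightarrow> s \<in> C"
    using closed unfolding closedin_scott_topology_iff by blast+
  define D where "D = {k. compact_element L k \<and> k \<in> C}"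
  have "directed L D"
    unfolding directed_def
  proof (intro conjI ballI)
    show "D \<subseteq> carrier L"
      using CL unfolding D_def by blast
    obtain x where x: "x \<in> C"
      using ne by blast
    then obtain k where "compact_element L k" "k \<sqsubseteq> x"
      using compact_below_directed[of x] CL unfolding directed_def by blast
    then show "D \<noteq> {}"
      using lower[OF x] unfolding D_def compact_element_def by blast
    fix k l assume kl: "k \<in> D" "l \<in> D"
    let ?U = "{z \<in> carrier L. k \<sqsubseteq> z}" and ?V = "{z \<in> carrier L. l \<sqsubseteq> z}"
    have op: "openin (scott_topology L) ?U" "openin (scott_topology L) ?V"
      using kl scott_open_up_compact unfolding D_def by auto
    have cl: "closedin (scott_topology L) (carrier L - ?U)"
      "closedin (scott_topology L) (carrier L - ?V)"
      using openin_closedin_eq[of "scott_topology L"] op by (simp_all del: openin_scott_topology)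
    have "k \<in> C" "l \<in> C" "k \<in> ?U" "l \<in> ?V"
      using kl CL unfolding D_def by auto
    \<comment> \<open>Neither complement contains \<open>C\<close>, since \<open>k\<close> and
      \<open>l\<close> are missing from the respective one. By irreducibility they do not cover
      \<open>C\<close> together, which leaves a point of \<open>C\<close> in both filters.\<close>
    then obtain y where y: "y \<in> C" "y \<in> ?U \<inter> ?V"
      using irr[OF cl] CL by blast
    have "scott_open L (?U \<inter> ?V)"
      using openin_Int[OF op] by simp
    \<comment> \<open>\<open>y\<close> need not be compact, so it is replaced by a compact element
      below it in the same open set; this stays in the lower set \<open>C\<close>.\<close>
    then obtain m where "compact_element L m" "m \<in> ?U \<inter> ?V" "m \<sqsubseteq> y"
      using compact_in_scott_open_algebraic y(2) by blast
    then show "\<exists>m\<in>D. k \<sqsubseteq> m \<and> l \<sqsubseteq> m"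
      using lower[OF y(1)] unfolding D_def by blast
  qed
  then obtain s where s: "is_lub L s D"
    using directed_sup_exists by blast
  have sC: "s \<in> C"
    using sups[OF \<open>directed L D\<close> s] unfolding D_def by blast
  \<comment> \<open>Every compact element below \<open>x\<close> belongs to the lower set
    \<open>C\<close>, hence to \<open>D\<close>, and is bounded by \<open>s\<close>;
    \<open>x\<close> is the least upper bound of these elements.\<close>
  have "x \<sqsubseteq> s" if x: "x \<in> C" for x
  proof -
    have "k \<sqsubseteq> s" if "compact_element L k" "k \<sqsubseteq> x" for k
      using s that lower[OF x, of k] unfolding is_lub_iff D_def compact_element_def by blast
    moreover have "is_lub L x {k. compact_element L k \<and> k \<sqsubseteq> x}"
      using compact_below_lub x CL by blast
    ultimately show ?thesis
      using sC CL by (auto simp: is_lub_iff)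
  qed
  then have "C = down_set L {s}"
    using CL lower[OF sC] unfolding down_set_def by blast
  then show thesis
    using that sC CL by blast
qed

text \<open>Point closures are principal ideals, so a generic point of \<open>C\<close> is a
  greatest element of \<open>C\<close>, and antisymmetry makes it unique.\<close>

lemma sober_space_scott_topology: "sober_space (scott_topology L)"
  unfolding sober_space_def
proof (intro conjI allI impI)
  fix C assume "irreducible_closed (scott_topology L) C"
  then obtain s where "s \<in> carrier L" "C = down_set L {s}"
    by (rule irreducible_closed_generic_point)
  then show "\<exists>!x. x \<in> topspace (scott_topology L) \<and> scott_topology L closure_of {x} = C"
    using closure_of_singleton_scott down_set_singleton_inject by auto
qed (rule t0_space_scott_topology)

end

section \<open>Directed sets, suprema and Scott open sets in products\<close>

lemma carrier_prod_order [simp]: "carrier (prod_order P Q) = carrier P \<times> carrier Q"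
  and le_prod_order [simp]: "p \<sqsubseteq>\<^bsub>prod_order P Q\<^esub> q \<longleftrightarrow> fst p \<sqsubseteq>\<^bsub>P\<^esub> fst q \<and> snd p \<sqsubseteq>\<^bsub>Q\<^esub> snd q"
  by (simp_all add: prod_order_def)

lemma directed_prod_orderD:
  assumes "directed (prod_order P Q) D"
  shows "directed P (fst ` D)" "directed Q (snd ` D)"
proof -
  have "D \<subseteq> carrier P \<times> carrier Q" and ne: "D \<noteq> {}"
    and ub: "\<And>d e. d \<in> D \<Longrightarrow> e \<in> D \<Longrightarrow>
      \<exists>z\<in>D. fst d \<sqsubseteq>\<^bsub>P\<^esub> fst z \<and> snd d \<sqsubseteq>\<^bsub>Q\<^esub> snd z \<and> fst e \<sqsubseteq>\<^bsub>P\<^esub> fst z \<and> snd e \<sqsubseteq>\<^bsub>Q\<^esub> snd z"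
    using assms by (simp_all add: directed_def conj_assoc)
  then have "fst ` D \<subseteq> carrier P" "snd ` D \<subseteq> carrier Q"
    by auto
  moreover have "\<exists>z\<in>D. fst d \<sqsubseteq>\<^bsub>P\<^esub> fst z \<and> fst e \<sqsubseteq>\<^bsub>P\<^esub> fst z"
    and "\<exists>z\<in>D. snd d \<sqsubseteq>\<^bsub>Q\<^esub> snd z \<and> snd e \<sqsubseteq>\<^bsub>Q\<^esub> snd z" if "d \<in> D" "e \<in> D" for d e
    using ub[OF that] by blast+
  ultimately show "directed P (fst ` D)" "directed Q (snd ` D)"
    unfolding directed_def using ne by simp_all
qed

lemma directed_prod_orderI:
  assumes D: "directed P D" and E: "directed Q E"
  shows "directed (prod_order P Q) (D \<times> E)"
  unfolding directed_def
proof (intro conjI ballI)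
  show "D \<times> E \<subseteq> carrier (prod_order P Q)" "D \<times> E \<noteq> {}"
    using D E unfolding directed_def by auto
  fix p q assume pq: "p \<in> D \<times> E" "q \<in> D \<times> E"
  obtain d where "d \<in> D" "fst p \<sqsubseteq>\<^bsub>P\<^esub> d" "fst q \<sqsubseteq>\<^bsub>P\<^esub> d"
    using D mem_Times_iff[THEN iffD1, OF pq(1)] mem_Times_iff[THEN iffD1, OF pq(2)]
    unfolding directed_def by metis
  moreover obtain e where "e \<in> E" "snd p \<sqsubseteq>\<^bsub>Q\<^esub> e" "snd q \<sqsubseteq>\<^bsub>Q\<^esub> e"
    using E mem_Times_iff[THEN iffD1, OF pq(1)] mem_Times_iff[THEN iffD1, OF pq(2)]
    unfolding directed_def by metis
  ultimately show "\<exists>r\<in>D \<times> E. p \<sqsubseteq>\<^bsub>prod_order P Q\<^esub> r \<and> q \<sqsubseteq>\<^bsub>prod_order P Q\<^esub> r"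
    by (intro bexI[of _ "(d, e)"]) auto
qed

text \<open>To test an upper bound \<open>u\<close> of the first projections, it is paired with
  \<open>t\<close>: \<open>(u, t)\<close> bounds \<open>D\<close>, hence is above
  \<open>(s, t)\<close>. The second coordinate is symmetric.\<close>

lemma is_lub_prod_orderD:
  assumes "is_lub (prod_order P Q) (s, t) D" "D \<subseteq> carrier P \<times> carrier Q"
  shows "is_lub P s (fst ` D)" "is_lub Q t (snd ` D)"
proof -
  have st: "s \<in> carrier P" "t \<in> carrier Q"
    and ub: "\<And>d. d \<in> D \<Longrightarrow> fst d \<sqsubseteq>\<^bsub>P\<^esub> s \<and> snd d \<sqsubseteq>\<^bsub>Q\<^esub> t"
    and least: "\<And>u v. u \<in> carrier P \<Longrightarrow> v \<in> carrier Q \<Longrightarrow>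
      (\<forall>d\<in>D. fst d \<sqsubseteq>\<^bsub>P\<^esub> u \<and> snd d \<sqsubseteq>\<^bsub>Q\<^esub> v) \<Longrightarrow> s \<sqsubseteq>\<^bsub>P\<^esub> u \<and> t \<sqsubseteq>\<^bsub>Q\<^esub> v"
    using assms by (auto simp: is_lub_iff)
  have carr: "\<And>d. d \<in> D \<Longrightarrow> fst d \<in> carrier P \<and> snd d \<in> carrier Q"
    using assms(2) by auto
  show "is_lub P s (fst ` D)"
    unfolding is_lub_iff using st ub carr least[OF _ st(2)] by simp
  show "is_lub Q t (snd ` D)"
    unfolding is_lub_iff using st ub carr least[OF st(1)] by simp
qed

lemma is_lub_prod_orderI:
  assumes s: "is_lub P s D" and t: "is_lub Q t E" and D: "directed P D" and E: "directed Q E"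
  shows "is_lub (prod_order P Q) (s, t) (D \<times> E)"
proof -
  have st: "s \<in> carrier P" "t \<in> carrier Q"
    using s t by simp_all
  \<comment> \<open>An upper bound of \<open>D \<times> E\<close> bounds \<open>D\<close> only if
    some element of \<open>E\<close> is available to form pairs, and conversely; these two elements
    fill the idle coordinate.\<close>
  obtain d\<^sub>0 e\<^sub>0 where de: "d\<^sub>0 \<in> D" "e\<^sub>0 \<in> E"
    using D E unfolding directed_def by blast
  have DE: "\<And>d. d \<in> D \<Longrightarrow> d \<in> carrier P" "\<And>e. e \<in> E \<Longrightarrow> e \<in> carrier Q"
    using D E unfolding directed_def by blast+
  have ub: "\<And>d. d \<in> D \<Longrightarrow> d \<sqsubseteq>\<^bsub>P\<^esub> s" "\<And>e. e \<in> E \<Longrightarrow> e \<sqsubseteq>\<^bsub>Q\<^esub> t"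
    using s t DE by (simp_all add: is_lub_iff)
  have "s \<sqsubseteq>\<^bsub>P\<^esub> u \<and> t \<sqsubseteq>\<^bsub>Q\<^esub> v"
    if uv: "u \<in> carrier P" "v \<in> carrier Q" and le: "\<And>d e. d \<in> D \<Longrightarrow> e \<in> E \<Longrightarrow> d \<sqsubseteq>\<^bsub>P\<^esub> u \<and> e \<sqsubseteq>\<^bsub>Q\<^esub> v"
    for u v
  proof
    show "s \<sqsubseteq>\<^bsub>P\<^esub> u"
      using s uv(1) le[OF _ de(2)] by (simp add: is_lub_iff)
    show "t \<sqsubseteq>\<^bsub>Q\<^esub> v"
      using t uv(2) le[OF de(1)] by (simp add: is_lub_iff)
  qed
  then show ?thesis
    using st ub DE by (simp add: is_lub_iff[of "prod_order P Q"])
qed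

lemma scott_open_Times:
  assumes U: "scott_open P U" and V: "scott_open Q V"
  shows "scott_open (prod_order P Q) (U \<times> V)"
proof -
  have UP: "U \<subseteq> carrier P" and VQ: "V \<subseteq> carrier Q"
    using U V unfolding scott_open_def by blast+
  have "D \<inter> (U \<times> V) \<noteq> {}"
    if D: "directed (prod_order P Q) D" and s: "is_lub (prod_order P Q) s D" "s \<in> U \<times> V" for D s
  proof -
    have DPQ: "D \<subseteq> carrier P \<times> carrier Q"
      using D unfolding directed_def by simp
    have "is_lub P (fst s) (fst ` D)" "is_lub Q (snd s) (snd ` D)"
      using is_lub_prod_orderD[of P Q "fst s" "snd s" D] s(1) DPQ by simp_all
    then have "\<exists>d\<in>fst ` D. d \<in> U" "\<exists>e\<in>snd ` D. e \<in> V"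
      using scott_openD_inacc[OF U directed_prod_orderD(1)[OF D]]
        scott_openD_inacc[OF V directed_prod_orderD(2)[OF D]] s(2) by (simp_all add: mem_Times_iff)
    then obtain d e where de: "d \<in> D" "fst d \<in> U" "e \<in> D" "snd e \<in> V"
      by blast
    \<comment> \<open>\<open>d\<close> reaches \<open>U\<close> in the first coordinate and
      \<open>e\<close> reaches \<open>V\<close> in the second; a common upper bound in
      \<open>D\<close> does both, as \<open>U\<close> and \<open>V\<close> are upper sets.\<close>
    then obtain z where z: "z \<in> D" "fst d \<sqsubseteq>\<^bsub>P\<^esub> fst z" "snd e \<sqsubseteq>\<^bsub>Q\<^esub> snd z"
      using D unfolding directed_def le_prod_order by meson
    then have "fst z \<in> U" "snd z \<in> V"
      using scott_openD_up[OF U de(2)] scott_openD_up[OF V de(4)] DPQ by auto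
    then show ?thesis
      using z(1) by (cases z) auto
  qed
  then show ?thesis
    using UP VQ scott_openD_up[OF U] scott_openD_up[OF V] unfolding scott_open_def[of "prod_order P Q"]
    by (intro conjI) auto
qed

text \<open>Open rectangles are Scott open, which gives one inclusion. For the other, the filters of
  compact elements supply an open rectangle around each point of a Scott open set.\<close>

lemma scott_topology_prod_order:
  assumes "algebraic_domain P" "algebraic_domain Q"
  shows "scott_topology (prod_order P Q) = prod_topology (scott_topology P) (scott_topology Q)"
  unfolding topology_eq
proof (intro allI iffI)
  interpret P: algebraic_domain P by fact
  interpret Q: algebraic_domain Q by fact
  fix W
  show "openin (prod_topology (scott_topology P) (scott_topology Q)) W"
    if "openin (scott_topology (prod_order P Q)) W"
    unfolding openin_prod_topology_alt
  proof (intro allI impI)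
    fix x y assume xy: "(x, y) \<in> W"
    have W: "scott_open (prod_order P Q) W"
      using that by simp
    then have x: "x \<in> carrier P" and y: "y \<in> carrier Q"
      using xy unfolding scott_open_def by auto
    \<comment> \<open>The pairs of compact elements below \<open>x\<close> and \<open>y\<close> form
      a directed set with supremum \<open>(x, y)\<close>, so \<open>W\<close> contains one of
      them.\<close>
    obtain k l where kl: "compact_element P k" "k \<sqsubseteq>\<^bsub>P\<^esub> x" "compact_element Q l" "l \<sqsubseteq>\<^bsub>Q\<^esub> y"
      "(k, l) \<in> W"
      using scott_openD_inacc[OF W
          directed_prod_orderI[OF P.compact_below_directed[OF x] Q.compact_below_directed[OF y]]
          is_lub_prod_orderI[OF P.compact_below_lub[OF x] Q.compact_below_lub[OF y]
            P.compact_below_directed[OF x] Q.compact_below_directed[OF y]] xy]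
      by blast
    \<comment> \<open>Since \<open>W\<close> is an upper set containing \<open>(k, l)\<close>, it
      contains the product of the two filters, an open rectangle around
      \<open>(x, y)\<close>.\<close>
    have "{z \<in> carrier P. k \<sqsubseteq>\<^bsub>P\<^esub> z} \<times> {z \<in> carrier Q. l \<sqsubseteq>\<^bsub>Q\<^esub> z} \<subseteq> W"
      using scott_openD_up[OF W kl(5)] by auto
    then show "\<exists>U V. openin (scott_topology P) U \<and> openin (scott_topology Q) V \<and>
        x \<in> U \<and> y \<in> V \<and> U \<times> V \<subseteq> W"
      using P.scott_open_up_compact[OF kl(1)] Q.scott_open_up_compact[OF kl(3)] kl x y
      by (intro exI[of _ "{z \<in> carrier P. k \<sqsubseteq>\<^bsub>P\<^esub> z}"] exI[of _ "{z \<in> carrier Q. l \<sqsubseteq>\<^bsub>Q\<^esub> z}"]) simp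
  qed
  show "openin (scott_topology (prod_order P Q)) W"
    if W: "openin (prod_topology (scott_topology P) (scott_topology Q)) W"
  proof (subst openin_subopen, intro ballI)
    fix p assume "p \<in> W"
    then obtain U V where UV: "scott_open P U" "scott_open Q V" "p \<in> U \<times> V" "U \<times> V \<subseteq> W"
      using W unfolding openin_prod_topology_alt openin_scott_topology
      by (metis SigmaI surj_pair)
    then show "\<exists>T. openin (scott_topology (prod_order P Q)) T \<and> p \<in> T \<and> T \<subseteq> W"
      using scott_open_Times[OF UV(1,2)] by auto
  qed
qed

section \<open>Artinian meet-continuous dcpos and complete lattices\<close>

lemma (in complete_lattice) dcpo: "dcpo L"
  by unfold_locales (auto simp: directed_def intro: sup_exists)

theorem corollary6p4:
  fixes P :: "'a gorder" and L :: "'b gorder"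
  shows "(dcpo P \<and> artinian P \<and> meet_continuous P \<longrightarrow>
            algebraic_domain P \<and>
            sober_space (scott_topology P) \<and>
            scott_topology (prod_order P P) = prod_topology (scott_topology P) (scott_topology P)) \<and>
         (complete_lattice L \<and> artinian L \<and> meet_continuous L \<longrightarrow> algebraic_domain L)"
proof (intro conjI impI)
  assume P: "dcpo P \<and> artinian P \<and> meet_continuous P"
  then interpret dcpo P
    by simp
  show alg: "algebraic_domain P"
    using P algebraic_domain_if_artinian_meet_continuous by simp
  then show "sober_space (scott_topology P)"
    by (rule algebraic_domain.sober_space_scott_topology)
  show "scott_topology (prod_order P P) = prod_topology (scott_topology P) (scott_topology P)"
    using alg alg by (rule scott_topology_prod_order)
next
  assume L: "complete_lattice L \<and> artinian L \<and> meet_continuous L"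
  then interpret dcpo L
    by (simp add: complete_lattice.dcpo)
  show "algebraic_domain L"
    using L algebraic_domain_if_artinian_meet_continuous by simp
qed

end
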